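(* Let $\mathcal{H}$ be a finite-dimensional complex Hilbert space, let $\mathbf{P} = (P_1, \dots, P_m)$ and $\mathbf{Q} = (Q_1, \dots, Q_n)$ be two projective measurements on $\mathcal{H}$, and let $\psi \in \mathcal{H}$ be a pure state (unit vector). Then $$H(\mathbf{P},\psi) + H(\mathbf{Q},\psi) \;\geq\; -2\log_2 \max_{i,j} \frac{|\langle \psi, P_i Q_j \psi\rangle|}{\|P_i\psi\|\,\|Q_j\psi\|},$$ where the maximum is taken over all $1\le i\le m$, $1\le j\le n$ satisfying $P_i\psi \neq 0$ and $Q_j\psi \neq 0$.
   Context: A measurement on a finite-dimensional complex Hilbert space $\mathcal{H}$ is a finite sequence $\mathbf{X} = (X_1,\dots,X_m)$ of positive (i.e. positive semidefinite) operators on $\mathcal{H}$ with $\sum_{i=1}^m X_i = I$. It is projective if each $X_i$ is an orthogonal projection. A pure state is a unit vector $\psi \in \mathcal{H}$. The entropy of $\mathbf{X}$ in the state $\psi$ is $H(\mathbf{X},\psi) = -\sum_{i=1}^m p_i \log_2 p_i$ with $p_i = \langle \psi, X_i\psi\rangle$ and the convention $0\log_2 0 = 0$. *)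

theory Defs
  imports "HOL-Analysis.Analysis"
begin

(* The inner product is conjugate-linear in its first argument.  The norm of the superclass
   is the one induced by the inner product. *)
class complex_inner = real_normed_vector +
  fixes scaleC :: "complex \<Rightarrow> 'a \<Rightarrow> 'a" (infixr "*\<^sub>C" 75)
    and cinner :: "'a \<Rightarrow> 'a \<Rightarrow> complex"
  assumes scaleC_add_right: "a *\<^sub>C (x + y) = a *\<^sub>C x + a *\<^sub>C y"
    and scaleC_add_left: "(a + b) *\<^sub>C x = a *\<^sub>C x + b *\<^sub>C x"
    and scaleC_scaleC: "a *\<^sub>C (b *\<^sub>C x) = (a * b) *\<^sub>C x"
    and scaleC_one: "1 *\<^sub>C x = x"
    and scaleR_scaleC: "r *\<^sub>R x = complex_of_real r *\<^sub>C x"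
    and cinner_commute: "cinner x y = cnj (cinner y x)"
    and cinner_add_right: "cinner x (y + z) = cinner x y + cinner x z"
    and cinner_scaleC_right: "cinner x (a *\<^sub>C y) = a * cinner x y"
    and cinner_self_nonneg: "cinner x x \<in> \<real>\<^sub>\<ge>\<^sub>0"
    and cinner_self_eq_0_iff: "cinner x x = 0 \<longleftrightarrow> x = 0"
    and norm_eq_sqrt_cinner: "norm x = sqrt (Re (cinner x x))"

lemma vector_space_scaleC:
  "vector_space (scaleC :: complex \<Rightarrow> 'a::complex_inner \<Rightarrow> 'a)"
  by unfold_locales
    (simp_all add: scaleC_add_right scaleC_add_left scaleC_scaleC scaleC_one)

(* A finite-dimensional complex inner product space is complete, so this predicate on a type of
   class complex_inner describes exactly the finite-dimensional complex Hilbert spaces. *)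
definition finite_dim_complex :: "'a::complex_inner itself \<Rightarrow> bool" where
  "finite_dim_complex _ \<longleftrightarrow>
     (\<exists>B :: 'a set. finite B \<and> module.span scaleC B = UNIV)"

definition clinear :: "('a::complex_inner \<Rightarrow> 'a) \<Rightarrow> bool" where
  "clinear A \<longleftrightarrow> Vector_Spaces.linear scaleC scaleC A"

(* Membership in the nonnegative reals includes that the complex number <x, A x> is real. *)
definition positive_op :: "('a::complex_inner \<Rightarrow> 'a) \<Rightarrow> bool" where
  "positive_op A \<longleftrightarrow> clinear A \<and> (\<forall>x. cinner x (A x) \<in> \<real>\<^sub>\<ge>\<^sub>0)"

definition orthogonal_projection :: "('a::complex_inner \<Rightarrow> 'a) \<Rightarrow> bool" where
  "orthogonal_projection A \<longleftrightarrow>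
     clinear A \<and> A \<circ> A = A \<and> (\<forall>x y. cinner (A x) y = cinner x (A y))"

(* A sequence (X_1, ..., X_m) is a function on nat of which only the values on {1..m} matter. *)
definition measurement :: "nat \<Rightarrow> (nat \<Rightarrow> 'a::complex_inner \<Rightarrow> 'a) \<Rightarrow> bool" where
  "measurement m X \<longleftrightarrow>
     (\<forall>i\<in>{1..m}. positive_op (X i)) \<and> (\<forall>x. (\<Sum>i=1..m. X i x) = x)"

definition projective_measurement :: "nat \<Rightarrow> (nat \<Rightarrow> 'a::complex_inner \<Rightarrow> 'a) \<Rightarrow> bool" where
  "projective_measurement m X \<longleftrightarrow>
     measurement m X \<and> (\<forall>i\<in>{1..m}. orthogonal_projection (X i))"

definition outcome_prob :: "('a::complex_inner \<Rightarrow> 'a) \<Rightarrow> 'a \<Rightarrow> real" where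
  "outcome_prob A \<psi> = Re (cinner \<psi> (A \<psi>))"

(* The convention 0 log 0 = 0 holds because log 2 0 is some real number, multiplied here by 0. *)
definition entropy_meas :: "nat \<Rightarrow> (nat \<Rightarrow> 'a::complex_inner \<Rightarrow> 'a) \<Rightarrow> 'a \<Rightarrow> real" where
  "entropy_meas m X \<psi> = - (\<Sum>i=1..m. outcome_prob (X i) \<psi> * log 2 (outcome_prob (X i) \<psi>))"

(* The standard model: complex n-space with its usual inner product and library norm. *)
instantiation vec :: ("{complex_inner}", finite) complex_inner
begin

definition scaleC_vec :: "complex \<Rightarrow> 'a ^ 'b \<Rightarrow> 'a ^ 'b" where
  "scaleC_vec a x = (\<chi> i. a *\<^sub>C (x $ i))"

definition cinner_vec :: "'a ^ 'b \<Rightarrow> 'a ^ 'b \<Rightarrow> complex" where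
  "cinner_vec x y = (\<Sum>i\<in>UNIV. cinner (x $ i) (y $ i))"

instance
proof
  fix x y z :: "'a ^ 'b" and a b :: complex and r :: real
  show "a *\<^sub>C (x + y) = a *\<^sub>C x + a *\<^sub>C y" "(a + b) *\<^sub>C x = a *\<^sub>C x + b *\<^sub>C x"
    "a *\<^sub>C (b *\<^sub>C x) = (a * b) *\<^sub>C x" "1 *\<^sub>C x = x" "r *\<^sub>R x = complex_of_real r *\<^sub>C x"
    by (simp_all add: scaleC_vec_def vec_eq_iff scaleC_add_right scaleC_add_left scaleC_scaleC
        scaleC_one scaleR_scaleC)
  show "cinner x y = cnj (cinner y x)"
    unfolding cinner_vec_def cnj_sum by (rule sum.cong[OF refl], rule cinner_commute)
  show "cinner x (y + z) = cinner x y + cinner x z" "cinner x (a *\<^sub>C y) = a * cinner x y"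
    by (simp_all add: cinner_vec_def scaleC_vec_def cinner_add_right cinner_scaleC_right
        sum.distrib sum_distrib_left)
  have nn: "Re (cinner (x $ i) (x $ i)) \<ge> 0" "Im (cinner (x $ i) (x $ i)) = 0" for i
    using cinner_self_nonneg[of "x $ i"] by (auto simp: complex_nonneg_Reals_iff)
  show "cinner x x \<in> \<real>\<^sub>\<ge>\<^sub>0"
    using nn by (simp add: cinner_vec_def complex_nonneg_Reals_iff sum_nonneg)
  have z: "Re (cinner (x $ i) (x $ i)) = 0 \<longleftrightarrow> x $ i = 0" for i
    using nn cinner_self_eq_0_iff[of "x $ i"] by (auto simp: complex_eq_iff)
  show "cinner x x = 0 \<longleftrightarrow> x = 0"
    using nn z by (simp add: cinner_vec_def complex_eq_iff sum_nonneg_eq_0_iff vec_eq_iff)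
  show "norm x = sqrt (Re (cinner x x))"
    using nn by (simp add: norm_vec_def L2_set_def cinner_vec_def norm_eq_sqrt_cinner)
qed

end

instantiation complex :: complex_inner
begin

definition "scaleC_complex (a :: complex) (x :: complex) = a * x"
definition "cinner_complex (x :: complex) (y :: complex) = cnj x * y"

instance
  by standard
    (auto simp: scaleC_complex_def cinner_complex_def algebra_simps scaleR_conv_of_real
      complex_nonneg_Reals_iff cmod_def power2_eq_square)

end

lemma finite_dim_complex_vec: "finite_dim_complex TYPE(complex ^ 'n)"
proof -
  have "(scaleC :: complex \<Rightarrow> complex ^ 'n \<Rightarrow> complex ^ 'n) = (*s)"
    by (simp add: fun_eq_iff vec_eq_iff scaleC_vec_def scaleC_complex_def)
  then show ?thesis
    unfolding finite_dim_complex_def using vec.finite_Basis vec.span_Basis by metis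
qed

end

(* With u_i = P_i psi, v_j = Q_j psi and c the maximal overlap, consider the entire function
     f(z) = sum_{i,j} |u_i|^z |v_j|^z <u_i, v_j>.
   On Re z = 0 it is the inner product of two vectors of norm one, because the u_i and the v_j are
   orthogonal families summing to psi; on Re z = 1 it is bounded by c sum |u_i|^2 |v_j|^2 = c.  The
   three lines theorem yields |f(x)| <= c^x for 0 <= x <= 1, with equality at x = 0.  Comparing
   derivatives at 0, where f'(0) = sum |u_i|^2 ln |u_i| + sum |v_j|^2 ln |v_j| is minus half the sum
   of the two entropies (in nats), gives the claim. *)
theory Submission
  imports Defs "HOL-Complex_Analysis.Conformal_Mappings"
begin

section \<open>The three lines theorem\<close>

text \<open>The maximum modulus principle needs a bounded domain. Damping \<open>f\<close> by a
  Gaussian allows the strip to be cut off to a rectangle, and the damping is removed in a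
  limit.\<close>

lemma phragmen_lindelof_strip:
  fixes f :: "complex \<Rightarrow> complex"
  assumes holo: "f holomorphic_on {z. 0 < Re z \<and> Re z < 1}"
    and cont: "continuous_on {z. 0 \<le> Re z \<and> Re z \<le> 1} f"
    and bdd: "\<And>z. 0 \<le> Re z \<Longrightarrow> Re z \<le> 1 \<Longrightarrow> cmod (f z) \<le> K"
    and left: "\<And>z. Re z = 0 \<Longrightarrow> cmod (f z) \<le> 1"
    and right: "\<And>z. Re z = 1 \<Longrightarrow> cmod (f z) \<le> 1"
    and z: "0 \<le> Re z" "Re z \<le> 1"
  shows "cmod (f z) \<le> 1"
proof -
  have K: "0 \<le> K" using bdd[OF z] norm_ge_zero order_trans by blast
  \<comment> \<open>The Gaussian factor makes the function small on the far horizontal sides of a rectangle.\<close>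
  have damped: "cmod (f z) * exp (\<epsilon> * Re (z\<^sup>2 - 1)) \<le> 1" if \<epsilon>: "\<epsilon> > 0" for \<epsilon>
  proof -
    \<comment> \<open>The first summand puts \<open>z\<close> into the rectangle; the other two give
      K <= epsilon * R <= epsilon * R^2, enough decay to beat the bound \<open>K\<close> on the
      horizontal sides.\<close>
    define R where "R = \<bar>Im z\<bar> + K / \<epsilon> + 1"
    define S where "S = cbox (Complex 0 (-R)) (Complex 1 R)"
    \<comment> \<open>The -1 keeps the real part of the exponent at most -epsilon * (Im w)^2 on the
      strip, so the bounds on the vertical sides survive.\<close>
    define h where "h w = f w * exp (of_real \<epsilon> * (w\<^sup>2 - 1))" for w
    have "K / \<epsilon> \<ge> 0" using K \<epsilon> by simp
    then have R1: "R \<ge> 1" "\<bar>Im z\<bar> \<le> R" "K / \<epsilon> \<le> R" by (auto simp: R_def)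
    then have "K \<le> \<epsilon> * R" using \<epsilon> by (simp add: field_simps)
    also have "\<dots> \<le> \<epsilon> * R\<^sup>2" using R1 \<epsilon> by (simp add: power2_eq_square)
    finally have KR: "K \<le> \<epsilon> * R\<^sup>2" .
    have normh: "cmod (h w) = cmod (f w) * exp (\<epsilon> * ((Re w)\<^sup>2 - (Im w)\<^sup>2 - 1))" for w
      by (simp add: h_def norm_mult power2_eq_square)
    have "cmod (h z) \<le> 1"
    proof (rule maximum_modulus_frontier[of h S])
      have "interior S \<subseteq> {z. 0 < Re z \<and> Re z < 1}"
        by (auto simp: S_def in_box_complex_iff)
      then show "h holomorphic_on interior S"
        unfolding h_def by (intro holomorphic_intros holomorphic_on_subset[OF holo])
      have "closure S \<subseteq> {z. 0 \<le> Re z \<and> Re z \<le> 1}"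
        by (auto simp: S_def in_cbox_complex_iff)
      then show "continuous_on (closure S) h"
        unfolding h_def by (intro continuous_intros continuous_on_subset[OF cont])
      show "bounded S" by (simp add: S_def)
      show "z \<in> S" using z R1 by (auto simp: S_def in_cbox_complex_iff)
      fix w assume "w \<in> frontier S"
      then have w: "0 \<le> Re w" "Re w \<le> 1"
        and cases: "Re w = 0 \<or> Re w = 1 \<or> \<bar>Im w\<bar> = R"
        by (auto simp: S_def frontier_cbox in_cbox_complex_iff in_box_complex_iff)
      have re: "(Re w)\<^sup>2 \<le> 1" using w by (simp add: power_le_one)
      show "cmod (h w) \<le> 1"
      proof (cases "\<bar>Im w\<bar> = R")
        case True
        then have im: "(Im w)\<^sup>2 = R\<^sup>2" by (metis power2_abs)
        have "\<epsilon> * ((Re w)\<^sup>2 - (Im w)\<^sup>2 - 1) \<le> \<epsilon> * - R\<^sup>2"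
          using re im \<epsilon> by (intro mult_left_mono) auto
        also have "\<dots> \<le> - K" using KR by simp
        finally have "cmod (h w) \<le> K * exp (- K)"
          unfolding normh using bdd[OF w] K by (intro mult_mono) auto
        also have "\<dots> \<le> exp K * exp (- K)"
          by (intro mult_right_mono) (use exp_ge_add_one_self[of K] in linarith, simp)
        finally show ?thesis by (simp add: exp_minus)
      next
        case False
        then have "cmod (f w) \<le> 1" using cases left right by blast
        moreover have "\<epsilon> * ((Re w)\<^sup>2 - (Im w)\<^sup>2 - 1) \<le> 0"
          using re \<epsilon> zero_le_power2[of "Im w"] by (intro mult_nonneg_nonpos) linarith+
        ultimately show ?thesis unfolding normh by (intro mult_le_one) auto
      qed
    qed
    then show ?thesis by (simp add: normh power2_eq_square)
  qed
  \<comment> \<open>With \<open>z\<close> fixed, the damping factor tends to 1 as epsilon tends to 0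
    from the right.\<close>
  have "((\<lambda>\<epsilon>. cmod (f z) * exp (\<epsilon> * Re (z\<^sup>2 - 1))) \<longlongrightarrow> cmod (f z) * exp (0 * Re (z\<^sup>2 - 1)))
      (at_right 0)"
    by (intro tendsto_intros)
  moreover have "\<forall>\<^sub>F \<epsilon> in at_right 0. cmod (f z) * exp (\<epsilon> * Re (z\<^sup>2 - 1)) \<le> 1"
    using eventually_at_right_less[of 0] by eventually_elim (rule damped)
  ultimately show ?thesis using tendsto_upperbound[of _ _ "at_right (0::real)" 1] by force
qed

text \<open>Dividing by the zero-free function A^(1-z) * B^z, whose modulus depends only on Re z and
  is bounded away from 0 on the strip, reduces both boundary bounds to 1.\<close>

theorem hadamard_three_lines:
  fixes f :: "complex \<Rightarrow> complex"
  assumes holo: "f holomorphic_on {z. 0 < Re z \<and> Re z < 1}"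
    and cont: "continuous_on {z. 0 \<le> Re z \<and> Re z \<le> 1} f"
    and bdd: "\<And>z. 0 \<le> Re z \<Longrightarrow> Re z \<le> 1 \<Longrightarrow> cmod (f z) \<le> K"
    and pos: "0 < A" "0 < B"
    and left: "\<And>z. Re z = 0 \<Longrightarrow> cmod (f z) \<le> A"
    and right: "\<And>z. Re z = 1 \<Longrightarrow> cmod (f z) \<le> B"
    and z: "0 \<le> Re z" "Re z \<le> 1"
  shows "cmod (f z) \<le> A powr (1 - Re z) * B powr Re z"
proof -
  define g where "g w = f w * exp (- ((1 - w) * of_real (ln A) + w * of_real (ln B)))" for w
  have normg: "cmod (g w) = cmod (f w) * exp (- ((1 - Re w) * ln A + Re w * ln B))" for w
    by (simp add: g_def norm_mult)
  have "cmod (g z) \<le> 1"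
  proof (rule phragmen_lindelof_strip[where f = g])
    show "g holomorphic_on {z. 0 < Re z \<and> Re z < 1}"
      unfolding g_def by (intro holomorphic_intros holo)
    show "continuous_on {z. 0 \<le> Re z \<and> Re z \<le> 1} g"
      unfolding g_def by (intro continuous_intros cont)
    show "cmod (g w) \<le> K * exp (\<bar>ln A\<bar> + \<bar>ln B\<bar>)" if w: "0 \<le> Re w" "Re w \<le> 1" for w
    proof -
      have "\<bar>(1 - Re w) * ln A\<bar> \<le> \<bar>ln A\<bar>" "\<bar>Re w * ln B\<bar> \<le> \<bar>ln B\<bar>"
        using w by (auto simp: abs_mult intro!: mult_left_le_one_le)
      moreover have "0 \<le> K" using bdd[OF w] norm_ge_zero order_trans by blast
      ultimately show ?thesis
        unfolding normg using bdd[OF w] by (intro mult_mono) auto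
    qed
    show "cmod (g w) \<le> 1" if "Re w = 0" for w
      unfolding normg using left[OF that] pos that by (simp add: exp_minus field_simps)
    show "cmod (g w) \<le> 1" if "Re w = 1" for w
      unfolding normg using right[OF that] pos that by (simp add: exp_minus field_simps)
  qed (use z in auto)
  then have "cmod (f z) \<le> exp ((1 - Re z) * ln A + Re z * ln B)"
    by (simp only: normg exp_minus) (simp add: divide_inverse[symmetric])
  then show ?thesis using pos by (simp add: powr_def exp_add)
qed

section \<open>Complex inner product spaces\<close>

lemma cinner_add_left: "cinner (x + y) z = cinner x z + cinner y z"
  for x y z :: "'a::complex_inner"
  by (metis cinner_commute cinner_add_right complex_cnj_add)

lemma cinner_scaleC_left: "cinner (a *\<^sub>C x) y = cnj a * cinner x y"
  for x y :: "'a::complex_inner"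
  by (metis cinner_commute cinner_scaleC_right complex_cnj_mult)

lemma cinner_zero_right [simp]: "cinner x 0 = 0"
  for x :: "'a::complex_inner"
  using cinner_add_right[of x 0 0] by simp

lemma cinner_zero_left [simp]: "cinner 0 x = 0"
  for x :: "'a::complex_inner"
  using cinner_add_left[of 0 0 x] by simp

lemma cinner_sum_right: "cinner x (\<Sum>i\<in>A. f i) = (\<Sum>i\<in>A. cinner x (f i))"
  for x :: "'a::complex_inner"
  by (induction A rule: infinite_finite_induct) (auto simp: cinner_add_right)

lemma cinner_sum_left: "cinner (\<Sum>i\<in>A. f i) x = (\<Sum>i\<in>A. cinner (f i) x)"
  for x :: "'a::complex_inner"
  by (induction A rule: infinite_finite_induct) (auto simp: cinner_add_left)

lemma cinner_self: "cinner x x = of_real ((norm x)\<^sup>2)"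
  for x :: "'a::complex_inner"
  using cinner_self_nonneg[of x]
  by (auto simp: complex_eq_iff norm_eq_sqrt_cinner complex_nonneg_Reals_iff)

lemma norm_scaleC: "norm (a *\<^sub>C x) = cmod a * norm x"
  for x :: "'a::complex_inner"
proof -
  have "complex_of_real ((norm (a *\<^sub>C x))\<^sup>2) = cnj a * a * of_real ((norm x)\<^sup>2)"
    by (simp only: cinner_self[symmetric] cinner_scaleC_left cinner_scaleC_right mult_ac)
  also have "\<dots> = of_real ((cmod a * norm x)\<^sup>2)"
    using complex_norm_square[of a] by (simp add: power_mult_distrib mult.commute)
  finally have "(norm (a *\<^sub>C x))\<^sup>2 = (cmod a * norm x)\<^sup>2" by (simp only: of_real_eq_iff)
  then show ?thesis by (simp add: power2_eq_iff_nonneg)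
qed

text \<open>The triangle inequality comes with the normed space class, so Cauchy-Schwarz is deduced
  from it: expand |x + y|^2 and compare with (|x| + |y|)^2.\<close>

lemma Re_cinner_le: "Re (cinner x y) \<le> norm x * norm y"
  for x y :: "'a::complex_inner"
proof -
  have "of_real ((norm (x + y))\<^sup>2) = cinner x x + cinner x y + (cnj (cinner x y) + cinner y y)"
    using cinner_commute[of y x]
    by (simp only: cinner_self[symmetric] cinner_add_left cinner_add_right) simp
  from arg_cong[OF this, of Re]
  have "(norm (x + y))\<^sup>2 = (norm x)\<^sup>2 + 2 * Re (cinner x y) + (norm y)\<^sup>2"
    by (simp add: cinner_self)
  moreover have "(norm (x + y))\<^sup>2 \<le> (norm x + norm y)\<^sup>2"
    by (intro power_mono norm_triangle_ineq) auto
  ultimately show ?thesis by (simp add: power2_sum)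
qed

text \<open>Multiplying \<open>y\<close> by a phase \<open>s\<close> of modulus 1 makes the inner
  product real and nonnegative without changing the norm of \<open>y\<close>.\<close>

lemma norm_cinner_le: "cmod (cinner x y) \<le> norm x * norm y"
  for x y :: "'a::complex_inner"
proof (cases "cinner x y = 0")
  case False
  define s where "s = cnj (cinner x y) / cmod (cinner x y)"
  have "s * cinner x y = of_real (cmod (cinner x y))"
    using False complex_norm_square[of "cinner x y"]
    by (simp add: s_def power2_eq_square field_simps)
  then have "cmod (cinner x y) = Re (cinner x (s *\<^sub>C y))"
    by (simp add: cinner_scaleC_right)
  also have "\<dots> \<le> norm x * norm (s *\<^sub>C y)" by (rule Re_cinner_le)
  also have "\<dots> = norm x * norm y"
    using False by (simp add: norm_scaleC s_def norm_divide)
  finally show ?thesis .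
qed simp

text \<open>Pythagoras. Coefficients 1 yield the total probability; unimodular coefficients leave
  the norm unchanged, which controls \<open>f\<close> on the imaginary axis.\<close>

lemma norm_sum_orthogonal:
  fixes u :: "'i \<Rightarrow> 'a::complex_inner"
  assumes fin: "finite A"
    and orth: "pairwise (\<lambda>i k. cinner (u i) (u k) = 0) A"
  shows "(norm (\<Sum>i\<in>A. a i *\<^sub>C u i))\<^sup>2 = (\<Sum>i\<in>A. (cmod (a i) * norm (u i))\<^sup>2)"
proof -
  have "complex_of_real ((norm (\<Sum>i\<in>A. a i *\<^sub>C u i))\<^sup>2)
      = (\<Sum>i\<in>A. \<Sum>k\<in>A. cinner (a i *\<^sub>C u i) (a k *\<^sub>C u k))"
    unfolding cinner_self[symmetric] cinner_sum_left by (simp only: cinner_sum_right)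
  also have "\<dots> = (\<Sum>i\<in>A. \<Sum>k\<in>A. if i = k then cinner (a i *\<^sub>C u i) (a i *\<^sub>C u i) else 0)"
    using orth by (intro sum.cong refl) (auto simp: pairwise_def cinner_scaleC_left cinner_scaleC_right)
  also have "\<dots> = of_real (\<Sum>i\<in>A. (cmod (a i) * norm (u i))\<^sup>2)"
    using fin by (simp add: cinner_self norm_scaleC)
  finally show ?thesis by (simp only: of_real_eq_iff)
qed

lemma cinner_sum_orthogonal:
  fixes u :: "'i \<Rightarrow> 'a::complex_inner"
  assumes fin: "finite A"
    and orth: "pairwise (\<lambda>i k. cinner (u i) (u k) = 0) A"
    and i: "i \<in> A"
  shows "cinner (u i) (\<Sum>k\<in>A. u k) = of_real ((norm (u i))\<^sup>2)"
proof -
  have "cinner (u i) (\<Sum>k\<in>A. u k) = (\<Sum>k\<in>A. if k = i then cinner (u i) (u i) else 0)"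
    unfolding cinner_sum_right using orth i by (intro sum.cong) (auto simp: pairwise_def)
  then show ?thesis using fin i by (simp add: cinner_self)
qed

section \<open>The uncertainty relation\<close>

text \<open>The overlap bound is multiplicative rather than a quotient, so that zero vectors may
  stay in the families.\<close>

theorem entropic_uncertainty_orthogonal_families:
  fixes u :: "'i \<Rightarrow> 'a::complex_inner" and v :: "'j \<Rightarrow> 'a"
  assumes fin: "finite A" "finite B"
    and orthu: "pairwise (\<lambda>i k. cinner (u i) (u k) = 0) A"
    and orthv: "pairwise (\<lambda>j k. cinner (v j) (v k) = 0) B"
    and sumu: "(\<Sum>i\<in>A. u i) = \<psi>" and sumv: "(\<Sum>j\<in>B. v j) = \<psi>"
    and unit: "norm \<psi> = 1"
    and overlap: "\<And>i j. i \<in> A \<Longrightarrow> j \<in> B \<Longrightarrow>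
      cmod (cinner (u i) (v j)) \<le> c * (norm (u i) * norm (v j))"
  shows "(\<Sum>i\<in>A. (norm (u i))\<^sup>2 * ln (norm (u i))) + (\<Sum>j\<in>B. (norm (v j))\<^sup>2 * ln (norm (v j)))
    \<le> ln c"
proof -
  \<comment> \<open>\<open>exp (ln (norm x))\<close> is 1 rather than 0 for \<open>x = 0\<close>; the factor \<open>cinner\<close> then vanishes.\<close>
  define a where "a i = ln (norm (u i))" for i
  define b where "b j = ln (norm (v j))" for j
  define f where "f z = (\<Sum>i\<in>A. \<Sum>j\<in>B. exp (z * of_real (a i + b j)) * cinner (u i) (v j))" for z
  have one: "(\<Sum>i\<in>A. (norm (u i))\<^sup>2) = 1" "(\<Sum>j\<in>B. (norm (v j))\<^sup>2) = 1"
    using norm_sum_orthogonal[OF fin(1) orthu, of "\<lambda>_. 1"]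
      norm_sum_orthogonal[OF fin(2) orthv, of "\<lambda>_. 1"] unit
    by (simp_all add: scaleC_one sumu sumv)
  have f0: "f 0 = 1"
  proof -
    have "f 0 = cinner (\<Sum>i\<in>A. u i) (\<Sum>j\<in>B. v j)"
      unfolding cinner_sum_left by (simp add: f_def cinner_sum_right)
    then show ?thesis using unit by (simp add: sumu sumv cinner_self)
  qed
  \<comment> \<open>A nonpositive \<open>c\<close> would make every inner product vanish, against
    \<open>f 0 = 1\<close>.\<close>
  have c: "c > 0"
  proof (rule ccontr)
    assume "\<not> c > 0"
    then have "cinner (u i) (v j) = 0" if "i \<in> A" "j \<in> B" for i j
      using overlap[OF that] mult_nonpos_nonneg[of c "norm (u i) * norm (v j)"]
      by (smt (verit) norm_ge_zero mult_nonneg_nonneg norm_eq_zero)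
    then show False using f0 by (simp add: f_def)
  qed
  have norm_term: "cmod (exp (z * of_real (a i + b j)) * cinner (u i) (v j))
      = exp (Re z * (a i + b j)) * cmod (cinner (u i) (v j))" for z i j
    by (simp add: norm_mult)
  have left: "cmod (f z) \<le> 1" if z: "Re z = 0" for z
  proof -
    \<comment> \<open>The exponent is conjugated because \<open>cinner\<close> conjugates its first
      argument. All exponents are purely imaginary here, so the coefficients have modulus 1.\<close>
    define x where "x = (\<Sum>i\<in>A. exp (cnj z * of_real (a i)) *\<^sub>C u i)"
    define y where "y = (\<Sum>j\<in>B. exp (z * of_real (b j)) *\<^sub>C v j)"
    have "f z = cinner x y"
      unfolding x_def y_def cinner_sum_left
      by (simp add: f_def cinner_sum_right cinner_scaleC_left cinner_scaleC_right exp_cnj exp_add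
          distrib_left sum_distrib_left mult_ac)
    moreover have "(norm x)\<^sup>2 = 1" "(norm y)\<^sup>2 = 1"
      unfolding x_def y_def
      using norm_sum_orthogonal[OF fin(1) orthu] norm_sum_orthogonal[OF fin(2) orthv] z one
      by simp_all
    then have "norm x = 1" "norm y = 1" by (simp_all add: power2_eq_1_iff) (smt (verit) norm_ge_zero)+
    ultimately show ?thesis using norm_cinner_le[of x y] by simp
  qed
  have right: "cmod (f z) \<le> c" if z: "Re z = 1" for z
  proof -
    have "exp (a i + b j) * cmod (cinner (u i) (v j)) \<le> c * ((norm (u i))\<^sup>2 * (norm (v j))\<^sup>2)"
      if "i \<in> A" "j \<in> B" for i j
    proof (cases "u i = 0 \<or> v j = 0")
      case False
      then have "exp (a i + b j) = norm (u i) * norm (v j)"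
        by (simp add: a_def b_def exp_add)
      then show ?thesis
        using mult_left_mono[OF overlap[OF that], of "norm (u i) * norm (v j)"]
        by (simp add: power2_eq_square mult_ac)
    qed auto
    then have "cmod (f z) \<le> (\<Sum>i\<in>A. \<Sum>j\<in>B. c * ((norm (u i))\<^sup>2 * (norm (v j))\<^sup>2))"
      unfolding f_def using z by (intro sum_norm_le) (simp add: norm_term del: of_real_add)
    also have "\<dots> = c * ((\<Sum>i\<in>A. (norm (u i))\<^sup>2) * (\<Sum>j\<in>B. (norm (v j))\<^sup>2))"
      unfolding sum_product by (simp add: sum_distrib_left)
    finally show ?thesis by (simp add: one)
  qed
  \<comment> \<open>Finite sums of such exponentials are bounded on the strip, which is the growth
    condition of the three lines theorem.\<close>
  have bdd: "cmod (f z) \<le> (\<Sum>i\<in>A. \<Sum>j\<in>B. exp \<bar>a i + b j\<bar> * cmod (cinner (u i) (v j)))"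
    if z: "0 \<le> Re z" "Re z \<le> 1" for z
  proof -
    have "Re z * t \<le> \<bar>t\<bar>" for t
      using z mult_left_le_one_le[of "\<bar>t\<bar>" "Re z"] abs_le_D1[of "Re z * t" "\<bar>t\<bar>"]
      by (simp add: abs_mult)
    then show ?thesis
      unfolding f_def by (intro sum_norm_le) (auto simp: norm_term simp del: of_real_add intro!: mult_right_mono)
  qed
  have deriv: "(f has_field_derivative
      (\<Sum>i\<in>A. \<Sum>j\<in>B. of_real (a i + b j) * cinner (u i) (v j))) (at 0)"
    unfolding f_def by (auto intro!: derivative_eq_intros sum.cong)
  have holo: "f holomorphic_on S" for S
    unfolding f_def by (intro holomorphic_intros)
  define L where "L = (\<Sum>i\<in>A. (norm (u i))\<^sup>2 * a i) + (\<Sum>j\<in>B. (norm (v j))\<^sup>2 * b j)"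
  \<comment> \<open>The derivative separates: the inner sum over one family is \<psi>, which is then
    rewritten as the sum of the other family, where orthogonality leaves only a squared
    norm.\<close>
  have "(\<Sum>i\<in>A. \<Sum>j\<in>B. of_real (a i + b j) * cinner (u i) (v j)) =
      (\<Sum>i\<in>A. of_real (a i) * (\<Sum>j\<in>B. cinner (u i) (v j)))
      + (\<Sum>j\<in>B. of_real (b j) * (\<Sum>i\<in>A. cinner (u i) (v j)))"
    by (simp add: distrib_right sum.distrib sum_distrib_left sum.swap[of _ B A])
  also have "\<dots> = (\<Sum>i\<in>A. of_real (a i) * cinner (u i) (\<Sum>k\<in>A. u k))
      + (\<Sum>j\<in>B. of_real (b j) * cnj (cinner (v j) (\<Sum>k\<in>B. v k)))"
    by (simp add: cinner_sum_left[symmetric] cinner_sum_right[symmetric] sumu sumv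
        cinner_commute[symmetric])
  also have "\<dots> = of_real L"
    using cinner_sum_orthogonal[OF fin(1) orthu] cinner_sum_orthogonal[OF fin(2) orthv]
    by (simp add: L_def mult.commute)
  finally have "(f has_field_derivative of_real L) (at (of_real 0))"
    using deriv by simp
  then have "((\<lambda>x. Re (f (of_real x))) has_real_derivative L) (at 0)"
    using has_field_derivative_Re[of "\<lambda>x. f (of_real x)" "of_real L" "at 0"]
      has_vector_derivative_real_field[of f "of_real L" 0 UNIV] by simp
  moreover have "((\<lambda>x. c powr x) has_real_derivative ln c) (at 0)"
    using c by (auto intro!: derivative_eq_intros)
  ultimately have D: "((\<lambda>x. Re (f (of_real x)) - c powr x) has_real_derivative L - ln c) (at 0)"
    by (rule DERIV_diff)
  \<comment> \<open>Re f and c^x agree at 0, so a larger slope of Re f would lift it above c^x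
    immediately to the right of 0.\<close>
  have "L \<le> ln c"
  proof (rule ccontr)
    assume "\<not> L \<le> ln c"
    then obtain d where d: "d > 0"
      "\<And>h. 0 < h \<Longrightarrow> h < d \<Longrightarrow> Re (f 0) - c powr 0 < Re (f (of_real h)) - c powr h"
      using DERIV_pos_inc_right[OF D] by auto
    \<comment> \<open>Halving \<open>d\<close> gives h < d, and the cap 1 keeps \<open>h\<close>
      inside the strip.\<close>
    define h where "h = min (d / 2) 1"
    have h: "0 < h" "h < d" "h \<le> 1" using d(1) by (auto simp: h_def)
    have "cmod (f (of_real h)) \<le> 1 powr (1 - Re (of_real h)) * c powr Re (of_real h)"
      by (rule hadamard_three_lines[OF holo holomorphic_on_imp_continuous_on[OF holo]];
          (erule (1) bdd | erule left | erule right | use h c in simp))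
    moreover have "c powr h < Re (f (of_real h))" using d(2)[OF h(1,2)] f0 c by simp
    ultimately show False using complex_Re_le_cmod[of "f (of_real h)"] by simp
  qed
  then show ?thesis by (simp add: L_def a_def b_def)
qed

section \<open>Projective measurements as orthogonal families of vectors\<close>

lemma projective_measurement_sum:
  "projective_measurement m P \<Longrightarrow> (\<Sum>i=1..m. P i x) = x"
  by (simp add: projective_measurement_def measurement_def)

lemma projective_measurement_cinner:
  assumes "projective_measurement m P" "i \<in> {1..m}"
  shows "cinner (P i x) y = cinner x (P i y)" "P i (P i x) = P i x"
  using assms by (auto simp: projective_measurement_def orthogonal_projection_def fun_eq_iff)

lemma outcome_prob_eq_norm:
  assumes "projective_measurement m P" "i \<in> {1..m}"
  shows "outcome_prob (P i) x = (norm (P i x))\<^sup>2"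
proof -
  have "cinner x (P i x) = cinner (P i x) (P i x)"
    by (simp add: projective_measurement_cinner[OF assms])
  then show ?thesis by (simp add: outcome_prob_def cinner_self)
qed

(* The squared norms of the P_k y sum to that of y = P_i x, which the term k = i already exhausts. *)
lemma projective_measurement_orthogonal:
  assumes P: "projective_measurement m P"
  shows "pairwise (\<lambda>i k. cinner (P i x) (P k x) = 0) {1..m}"
proof (rule pairwiseI)
  fix i k assume ik: "i \<in> {1..m}" "k \<in> {1..m}" "i \<noteq> k"
  define y where "y = P i x"
  have "(\<Sum>l=1..m. (norm (P l y))\<^sup>2) = (\<Sum>l=1..m. Re (cinner y (P l y)))"
    using outcome_prob_eq_norm[OF P] by (intro sum.cong) (auto simp: outcome_prob_def)
  also have "\<dots> = (norm y)\<^sup>2"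
    by (simp add: Re_sum[symmetric] cinner_sum_right[symmetric] projective_measurement_sum[OF P]
        cinner_self del: Re_sum One_nat_def)
  also have "\<dots> = (norm (P i y))\<^sup>2"
    by (simp add: y_def projective_measurement_cinner[OF P ik(1)])
  finally have "(\<Sum>l\<in>{1..m} - {i}. (norm (P l y))\<^sup>2) = 0"
    using sum.remove[of "{1..m}" i "\<lambda>l. (norm (P l y))\<^sup>2"] ik by simp
  then have "P k y = 0" using ik by (simp add: sum_nonneg_eq_0_iff)
  then show "cinner (P i x) (P k x) = 0"
    using projective_measurement_cinner(1)[OF P ik(2), of "P i x" x] by (simp add: y_def)
qed

text \<open>Each probability is a squared norm, so its binary logarithm is 2 / ln 2 times the
  natural logarithm of the norm. Terms with \<open>P i x = 0\<close> vanish on both sides.\<close>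

lemma entropy_meas_eq_norm:
  assumes "projective_measurement m P"
  shows "entropy_meas m P x = - 2 / ln 2 * (\<Sum>i=1..m. (norm (P i x))\<^sup>2 * ln (norm (P i x)))"
proof -
  have "outcome_prob (P i) x * log 2 (outcome_prob (P i) x)
      = 2 / ln 2 * ((norm (P i x))\<^sup>2 * ln (norm (P i x)))" if "i \<in> {1..m}" for i
    using outcome_prob_eq_norm[OF assms that, of x]
    by (cases "P i x = 0") (auto simp: log_def ln_realpow)
  then show ?thesis by (simp add: entropy_meas_def sum_distrib_left sum_negf[symmetric])
qed

theorem theorem2p1:
  fixes P Q :: "nat \<Rightarrow> 'h::complex_inner \<Rightarrow> 'h"
    and m n :: nat
    and \<psi> :: 'h
  assumes "finite_dim_complex TYPE('h)"
    and "projective_measurement m P"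
    and "projective_measurement n Q"
    and "norm \<psi> = 1"
  shows "entropy_meas m P \<psi> + entropy_meas n Q \<psi> \<ge>
    - 2 * log 2 (Max {cmod (cinner \<psi> (P i (Q j \<psi>))) / (norm (P i \<psi>) * norm (Q j \<psi>)) | i j.
        i \<in> {1..m} \<and> j \<in> {1..n} \<and> P i \<psi> \<noteq> 0 \<and> Q j \<psi> \<noteq> 0})"
proof -
  note P = assms(2) and Q = assms(3)
  define g where "g i j = cmod (cinner \<psi> (P i (Q j \<psi>))) / (norm (P i \<psi>) * norm (Q j \<psi>))" for i j
  define S where "S = {g i j | i j. i \<in> {1..m} \<and> j \<in> {1..n} \<and> P i \<psi> \<noteq> 0 \<and> Q j \<psi> \<noteq> 0}"
  have fin: "finite S"
    by (rule finite_subset[of _ "case_prod g ` ({1..m} \<times> {1..n})"]) (auto simp: S_def)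
  have overlap: "cmod (cinner (P i \<psi>) (Q j \<psi>)) \<le> Max S * (norm (P i \<psi>) * norm (Q j \<psi>))"
    if ij: "i \<in> {1..m}" "j \<in> {1..n}" for i j
  \<comment> \<open>If one of the vectors is 0, both sides are 0; otherwise \<open>g i j\<close>
    lies in \<open>S\<close>, so \<open>Max\<close> is taken of a nonempty set.\<close>
  proof (cases "P i \<psi> = 0 \<or> Q j \<psi> = 0")
    case False
    then have "g i j \<le> Max S" using ij by (intro Max_ge fin) (auto simp: S_def)
    then show ?thesis
      using False projective_measurement_cinner(1)[OF P ij(1)] by (simp add: g_def field_simps)
  qed auto
  have "(\<Sum>i=1..m. (norm (P i \<psi>))\<^sup>2 * ln (norm (P i \<psi>)))
      + (\<Sum>j=1..n. (norm (Q j \<psi>))\<^sup>2 * ln (norm (Q j \<psi>))) \<le> ln (Max S)"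
    using projective_measurement_orthogonal[OF P] projective_measurement_orthogonal[OF Q]
      projective_measurement_sum[OF P] projective_measurement_sum[OF Q] assms(4) overlap
    by (intro entropic_uncertainty_orthogonal_families) auto
  \<comment> \<open>The 2 passes from norms to probabilities inside the logarithm, the 1 / ln 2 from
    nats to bits.\<close>
  from mult_left_mono[OF this, of "2 / ln 2"]
  have "entropy_meas m P \<psi> + entropy_meas n Q \<psi> \<ge> - 2 * log 2 (Max S)"
    by (simp add: entropy_meas_eq_norm[OF P] entropy_meas_eq_norm[OF Q] log_def algebra_simps)
  then show ?thesis by (simp add: S_def g_def)
qed

end
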